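(* Let $G$ be a finite simple undirected graph with $n$ vertices and $m$ edges. Let $p,k,t$ be integers with $t\ge 1$, $k\ge t+2$, $p\ge 2^tn+k$ and $m\le\frac{(k-t)n}{2}+\frac{k^2}{2^{t+1}}$. Then $$LE(G^{t*}\vee\overline{K_p})=2^tn(t+2)+(p-2^tn)\frac{2m'}{n'}+2^t(2m),$$ where $\frac{2m'}{n'}=\frac{2^{t+1}m+2^t t n+2^{t+1}pn}{p+2^tn}$ is the average vertex degree of $G^{t*}\vee\overline{K_p}$.
   Context: The Laplacian energy of a graph $H$ with $N$ vertices, $M$ edges and Laplacian eigenvalues $\nu_1,\dots,\nu_N$ (eigenvalues of $D-A$, with $A$ the adjacency matrix and $D$ the diagonal degree matrix) is $LE(H)=\sum_{i=1}^N|\nu_i-\frac{2M}{N}|$. For $G$ with vertex set $\{v_1,\dots,v_n\}$, the extended double cover $G^*$ is the bipartite graph with parts $X=\{x_1,\dots,x_n\}$, $Y=\{y_1,\dots,y_n\}$, where $x_i$ is adjacent to $y_j$ iff $i=j$ or $v_i$ is adjacent to $v_j$ in $G$; the iterated version is $G^{1*}=G^*$, $G^{t*}=(G^{(t-1)*})^*$. The join $H_1\vee H_2$ is the disjoint union of $H_1$ and $H_2$ together with all edges between $V(H_1)$ and $V(H_2)$. $\overline{K_p}$ is the edgeless graph on $p$ vertices. *)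

theory Defs
  imports "Graph_Theory.Pair_Digraph" "Jordan_Normal_Form.Char_Poly"
begin

text \<open>
  Finite simple undirected graphs are the symmetric loop-free finite digraphs of the locale
  \<^locale>\<open>pair_graph\<close>: an edge between u and v is the pair of arcs (u,v), (v,u), and the degree
  of a vertex is its out-degree.
\<close>

definition num_verts :: "'a pair_pre_digraph \<Rightarrow> nat" where
  "num_verts G = card (pverts G)"

definition num_edges :: "'a pair_pre_digraph \<Rightarrow> nat" where
  "num_edges G = card {{u, v} | u v. (u, v) \<in> parcs G}"

definition average_degree :: "'a pair_pre_digraph \<Rightarrow> real" where
  "average_degree G = (\<Sum>v\<in>pverts G. real (out_degree (with_proj G) v)) / real (num_verts G)"

section \<open>Laplacian energy\<close>

text \<open>Matrices are indexed by the positions in a list that enumerates the vertices.\<close>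

definition adjacency_mat :: "'a list \<Rightarrow> 'a pair_pre_digraph \<Rightarrow> real mat" where
  "adjacency_mat vs G =
     mat (length vs) (length vs) (\<lambda>(i, j). if (vs ! i, vs ! j) \<in> parcs G then 1 else 0)"

definition degree_mat :: "'a list \<Rightarrow> 'a pair_pre_digraph \<Rightarrow> real mat" where
  "degree_mat vs G =
     mat (length vs) (length vs)
       (\<lambda>(i, j). if i = j then real (out_degree (with_proj G) (vs ! i)) else 0)"

definition laplacian_mat :: "'a list \<Rightarrow> 'a pair_pre_digraph \<Rightarrow> real mat" where
  "laplacian_mat vs G = degree_mat vs G - adjacency_mat vs G"

definition vertex_list :: "'a pair_pre_digraph \<Rightarrow> 'a list" where
  "vertex_list G = (SOME vs. distinct vs \<and> set vs = pverts G)"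

text \<open>
  The eigenvalues with multiplicity. The choice of the enumeration is immaterial, since another
  one gives a similar matrix. The matrix is real symmetric, so that no eigenvalue is lost by
  taking the roots of the characteristic polynomial in the reals.
\<close>

definition laplacian_eigenvalues :: "'a pair_pre_digraph \<Rightarrow> real multiset" where
  "laplacian_eigenvalues G = proots (char_poly (laplacian_mat (vertex_list G) G))"

definition laplacian_energy :: "'a pair_pre_digraph \<Rightarrow> real" where
  "laplacian_energy G =
     (\<Sum>\<nu>\<in>#laplacian_eigenvalues G. \<bar>\<nu> - 2 * real (num_edges G) / real (num_verts G)\<bar>)"

section \<open>Extended double covers\<close>

text \<open>
  The type of vertices must not change under the double cover, for it to be iterated. So the
  original vertices are embedded by \<open>Orig\<close>, and \<open>X v\<close>, \<open>Y v\<close> are the two copies of a vertex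
  \<open>v\<close> that may itself come from an earlier cover.
\<close>

datatype 'a cover_vertex = Orig 'a | X "'a cover_vertex" | Y "'a cover_vertex"

definition embed_graph :: "'a pair_pre_digraph \<Rightarrow> 'a cover_vertex pair_pre_digraph" where
  "embed_graph G =
     \<lparr> pverts = Orig ` pverts G, parcs = map_prod Orig Orig ` parcs G \<rparr>"

definition extended_double_cover ::
  "'a cover_vertex pair_pre_digraph \<Rightarrow> 'a cover_vertex pair_pre_digraph" where
  "extended_double_cover G =
     (let E = {(X u, Y v) | u v. u \<in> pverts G \<and> v \<in> pverts G \<and> (u = v \<or> (u, v) \<in> parcs G)}
      in \<lparr> pverts = X ` pverts G \<union> Y ` pverts G, parcs = E \<union> E\<inverse> \<rparr>)"

definition iterated_double_cover ::
  "nat \<Rightarrow> 'a pair_pre_digraph \<Rightarrow> 'a cover_vertex pair_pre_digraph" where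
  "iterated_double_cover t G = (extended_double_cover ^^ t) (embed_graph G)"

section \<open>Joins and edgeless graphs\<close>

definition graph_join ::
  "'a pair_pre_digraph \<Rightarrow> 'b pair_pre_digraph \<Rightarrow> ('a + 'b) pair_pre_digraph" where
  "graph_join G H =
     \<lparr> pverts = pverts G <+> pverts H,
       parcs = map_prod Inl Inl ` parcs G \<union> map_prod Inr Inr ` parcs H
         \<union> (Inl ` pverts G) \<times> (Inr ` pverts H) \<union> (Inr ` pverts H) \<times> (Inl ` pverts G) \<rparr>"

definition edgeless_graph :: "nat \<Rightarrow> nat pair_pre_digraph" where
  "edgeless_graph p = \<lparr> pverts = {..<p}, parcs = {} \<rparr>"

section \<open>Well-formedness\<close>

lemma pair_graph_iff:
  "pair_graph G \<longleftrightarrow> finite (pverts G) \<and> parcs G \<subseteq> pverts G \<times> pverts G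
     \<and> sym (parcs G) \<and> irrefl (parcs G)" (is "?L \<longleftrightarrow> ?R")
proof
  assume ?L
  then interpret pair_graph G .
  show ?R
    using pair_finite_verts wellformed' pair_sym_arcs no_loops'
    by (fastforce simp: symmetric_def irrefl_def)
next
  assume R: ?R
  then have "finite (parcs G)"
    using finite_subset by blast
  with R show ?L
    by unfold_locales (auto simp: symmetric_def irrefl_def)
qed

lemma pair_graph_embed_graph: "pair_graph G \<Longrightarrow> pair_graph (embed_graph G)"
  unfolding pair_graph_iff by (auto simp: embed_graph_def sym_def irrefl_def map_prod_def)

lemma pair_graph_extended_double_cover:
  "pair_graph G \<Longrightarrow> pair_graph (extended_double_cover G)"
  unfolding pair_graph_iff
  by (auto simp: extended_double_cover_def Let_def sym_def irrefl_def)

lemma pair_graph_iterated_double_cover: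
  "pair_graph G \<Longrightarrow> pair_graph (iterated_double_cover t G)"
  by (induction t)
     (auto simp: iterated_double_cover_def pair_graph_embed_graph pair_graph_extended_double_cover)

lemma pair_graph_graph_join: "pair_graph G \<Longrightarrow> pair_graph H \<Longrightarrow> pair_graph (graph_join G H)"
  unfolding pair_graph_iff by (auto simp: graph_join_def sym_def irrefl_def map_prod_def)

lemma pair_graph_edgeless_graph: "pair_graph (edgeless_graph p)"
  unfolding pair_graph_iff by (auto simp: edgeless_graph_def sym_def irrefl_def)

end

theory Submission
  imports Defs "Jordan_Normal_Form.Schur_Decomposition"
begin

text \<open>
  Write \<open>K\<close> for the iterated cover, \<open>N\<close> for its number of vertices, \<open>S\<close> for the sum of its degrees and
  \<open>H\<close> for its join with \<open>p\<close> isolated vertices. If \<open>\<mu>\<^sub>1 = 0, \<mu>\<^sub>2, \<dots>, \<mu>\<^sub>N\<close> are the Laplacian eigenvalues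
  of \<open>K\<close>, then those of \<open>H\<close> are \<open>0\<close>, \<open>N + p\<close>, the value \<open>N\<close> with multiplicity \<open>p - 1\<close>, and
  \<open>\<mu>\<^sub>2 + p, \<dots>, \<mu>\<^sub>N + p\<close>. Let \<open>a = (S + 2pN) / (p + N)\<close> be the average degree of \<open>H\<close>. The bound on the
  number of edges says that \<open>S \<le> (N + k) k\<close>; as \<open>p \<ge> N + k\<close>, this yields \<open>S \<le> p (p - N)\<close>, which is
  equivalent to \<open>a \<le> p\<close>. Moreover \<open>N \<le> p\<close> gives \<open>N \<le> a\<close>. As \<open>\<mu>\<^sub>i \<ge> 0\<close>, the sign of
  \<open>\<nu> - a\<close> is known for every eigenvalue \<open>\<nu>\<close> of \<open>H\<close>: it is nonpositive for
  \<open>\<nu> = 0\<close> and \<open>\<nu> = N\<close>, and nonnegative for \<open>\<nu> = \<mu>\<^sub>i + p\<close> and \<open>\<nu> = N + p\<close>. So the energy is a signed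
  sum of eigenvalues, and through the trace \<open>\<Sum>\<mu>\<^sub>i = S\<close> it depends on \<open>K\<close> only by \<open>N\<close> and \<open>S\<close>. A cover
  doubles the vertices and adds one to every degree, so that \<open>N = 2\<^sup>t n\<close> and
  \<open>S = 2\<^sup>t (2m + tn)\<close>.

  The spectrum of \<open>H\<close> comes from \<open>char_poly_join_block\<close>, an identity of characteristic polynomials.
  It is stated without division, with the two factors \<open>x - N\<close> and \<open>x - p\<close> multiplied to the other
  side; therefore it also covers the graph without vertices, in which no eigenvalue \<open>\<mu>\<^sub>1\<close> exists to be
  removed. That the characteristic polynomial of \<open>pI + L(K)\<close> has only real roots, all at least \<open>p\<close>,
  follows from the quadratic form of the Laplacian over the complex numbers
  (\<open>eigenvalue_shifted_weighted_laplacian\<close>), and the sum of the roots from a Schur triangularisation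
  (\<open>sum_roots_char_poly\<close>).
\<close>

section \<open>Determinants of block matrices\<close>

lemma mult_scalar_mat:
  fixes A :: "'a :: comm_semiring_1 mat"
  assumes "A \<in> carrier_mat n m"
  shows "A * (d \<cdot>\<^sub>m 1\<^sub>m m) = d \<cdot>\<^sub>m A" "(d \<cdot>\<^sub>m 1\<^sub>m n) * A = d \<cdot>\<^sub>m A"
  using assms
  by (simp_all add: mult_smult_distrib[OF assms, of "1\<^sub>m m" m] mult_smult_assoc_mat[of _ n n _ m])

text \<open>
  Column elimination on the left block column. Scaling it by the pivot \<open>d\<close> avoids inverting \<open>d\<close>, so
  that the formula holds over polynomial rings; the price is the power of \<open>d\<close> on the left.
\<close>

lemma det_schur_complement_lower_right:
  fixes A :: "'a :: idom mat"
  assumes A: "A \<in> carrier_mat n n" and B: "B \<in> carrier_mat n m" and C: "C \<in> carrier_mat m n"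
  shows "det (four_block_mat A B C (d \<cdot>\<^sub>m 1\<^sub>m m)) * d ^ n = det (d \<cdot>\<^sub>m A - B * C) * d ^ m"
proof -
  let ?M = "four_block_mat A B C (d \<cdot>\<^sub>m 1\<^sub>m m)"
  let ?E = "four_block_mat (d \<cdot>\<^sub>m 1\<^sub>m n) (0\<^sub>m n m) (- C) (1\<^sub>m m)"
  have *: "A * (d \<cdot>\<^sub>m 1\<^sub>m n) + B * (- C) = d \<cdot>\<^sub>m A - B * C"
    "A * 0\<^sub>m n m + B * 1\<^sub>m m = B"
    "C * (d \<cdot>\<^sub>m 1\<^sub>m n) + (d \<cdot>\<^sub>m 1\<^sub>m m) * (- C) = 0\<^sub>m m n"
    "C * 0\<^sub>m n m + (d \<cdot>\<^sub>m 1\<^sub>m m) * 1\<^sub>m m = d \<cdot>\<^sub>m 1\<^sub>m m"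
    using A B C
    by (auto simp: mult_scalar_mat[OF A] mult_scalar_mat[OF C] mult_scalar_mat[of "- C" m n]
        mult_scalar_mat[of "1\<^sub>m m"])
  have "?M * ?E = four_block_mat (d \<cdot>\<^sub>m A - B * C) B (0\<^sub>m m n) (d \<cdot>\<^sub>m 1\<^sub>m m)"
    using A B C by (subst mult_four_block_mat[of _ n n _ m _ m _ _ n _ m])
      (auto simp only: * intro!: smult_carrier_mat
        uminus_carrier_mat one_carrier_mat zero_carrier_mat)
  then have "det (?M * ?E) = det (d \<cdot>\<^sub>m A - B * C) * d ^ m"
    using A B C by (simp, subst det_four_block_mat_lower_left_zero[of _ n _ m]) auto
  moreover have "det (?M * ?E) = det ?M * det ?E"
    using A B C by (intro det_mult[of _ "n + m"]) auto
  moreover have "det ?E = d ^ n"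
    using C by (subst det_four_block_mat_upper_right_zero[of _ n _ m]) auto
  ultimately show ?thesis by simp
qed

lemma det_schur_complement_upper_left:
  fixes D :: "'a :: idom mat"
  assumes B: "B \<in> carrier_mat n m" and C: "C \<in> carrier_mat m n" and D: "D \<in> carrier_mat m m"
  shows "det (four_block_mat (d \<cdot>\<^sub>m 1\<^sub>m n) B C D) * d ^ m = d ^ n * det (d \<cdot>\<^sub>m D - C * B)"
proof -
  let ?M = "four_block_mat (d \<cdot>\<^sub>m 1\<^sub>m n) B C D"
  let ?E = "four_block_mat (1\<^sub>m n) (- B) (0\<^sub>m m n) (d \<cdot>\<^sub>m 1\<^sub>m m)"
  have *: "C * (- B) + D * (d \<cdot>\<^sub>m 1\<^sub>m m) = d \<cdot>\<^sub>m D - C * B"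
    using B C D by (intro eq_matI) (auto simp: mult_scalar_mat[OF D])
  have **: "(d \<cdot>\<^sub>m 1\<^sub>m n) * 1\<^sub>m n + B * 0\<^sub>m m n = d \<cdot>\<^sub>m 1\<^sub>m n"
    "(d \<cdot>\<^sub>m 1\<^sub>m n) * (- B) + B * (d \<cdot>\<^sub>m 1\<^sub>m m) = 0\<^sub>m n m"
    "C * 1\<^sub>m n + D * 0\<^sub>m m n = C"
    using B C D
    by (auto simp: mult_scalar_mat[OF B] mult_scalar_mat[of "- B" n m] mult_scalar_mat[of "1\<^sub>m n"])
  have "?M * ?E = four_block_mat (d \<cdot>\<^sub>m 1\<^sub>m n) (0\<^sub>m n m) C (d \<cdot>\<^sub>m D - C * B)"
    using B C D by (subst mult_four_block_mat[of _ n n _ m _ m _ _ n _ m])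
      (auto simp only: * ** intro!: smult_carrier_mat
        uminus_carrier_mat one_carrier_mat zero_carrier_mat)
  then have "det (?M * ?E) = d ^ n * det (d \<cdot>\<^sub>m D - C * B)"
    using B C D by (simp, subst det_four_block_mat_upper_right_zero[of _ n _ m]) auto
  moreover have "det (?M * ?E) = det ?M * det ?E"
    using B C D by (intro det_mult[of _ "n + m"]) auto
  moreover have "det ?E = d ^ m"
    using B by (subst det_four_block_mat_lower_left_zero[of _ n _ m]) auto
  ultimately show ?thesis by simp
qed

lemma one_smult_mat: "(1 :: 'a :: monoid_mult) \<cdot>\<^sub>m A = A"
  by (intro eq_matI) auto

text \<open>
  Both sides are, up to a power of \<open>d\<close>, the determinant of the block matrix with diagonal blocks
  \<open>d I\<close> and \<open>I\<close> and off-diagonal blocks \<open>B\<close> and \<open>C\<close>, expanded by either of its two Schur complements.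
\<close>

lemma det_sylvester:
  fixes B :: "'a :: idom mat"
  assumes B: "B \<in> carrier_mat n m" and C: "C \<in> carrier_mat m n"
  shows "det (d \<cdot>\<^sub>m 1\<^sub>m n - B * C) * d ^ m = d ^ n * det (d \<cdot>\<^sub>m 1\<^sub>m m - C * B)"
  using det_schur_complement_lower_right[OF _ B C, of "d \<cdot>\<^sub>m 1\<^sub>m n" 1]
    det_schur_complement_upper_left[OF B C, of "1\<^sub>m m" d]
  by (simp add: one_smult_mat)

abbreviation const_mat :: "nat \<Rightarrow> nat \<Rightarrow> 'a \<Rightarrow> 'a mat" where
  "const_mat n m c \<equiv> mat n m (\<lambda>_. c)"

lemma const_mat_mult:
  fixes b c :: "'a :: comm_semiring_1"
  shows "const_mat n m b * const_mat m l c = const_mat n l (of_nat m * b * c)"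
  by (rule eq_matI) (auto simp: scalar_prod_def ac_simps)

text \<open>
  A constant matrix has rank one, being a column times a row, so Sylvester's identity reduces the
  determinant to one of size \<open>1\<close>.
\<close>

lemma det_scalar_minus_const_mat:
  fixes d c :: "'a :: idom"
  shows "det (d \<cdot>\<^sub>m 1\<^sub>m n - const_mat n n c) * d = d ^ n * (d - of_nat n * c)"
proof -
  have "det (d \<cdot>\<^sub>m 1\<^sub>m 1 - const_mat 1 1 (of_nat n * c)) = d - of_nat n * c"
    by (subst det_single) auto
  then show ?thesis
    using det_sylvester[of "const_mat n 1 c" n 1 "const_mat 1 n 1" d]
    by (simp add: const_mat_mult del: One_nat_def)
qed

text \<open>
  With \<open>\<alpha> = x - q\<close> and \<open>\<beta> = x - s\<close>, eliminating the scalar block leaves the determinant of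
  \<open>\<alpha> (x I - A) - p J\<close>, where \<open>J\<close> is the all-ones matrix. The row sums of \<open>A\<close> give
  \<open>(x I - A) J = \<beta> J\<close>, hence \<open>\<beta> (\<alpha> (x I - A) - p J) = (x I - A) (\<alpha> \<beta> I - p J)\<close>. So the rank one
  perturbation splits off as a factor whose determinant is known.
\<close>

lemma char_poly_join_block:
  fixes A :: "'a :: idom mat"
  assumes A: "A \<in> carrier_mat n n"
    and row_sums: "\<And>i. i < n \<Longrightarrow> (\<Sum>j<n. A $$ (i, j)) = s"
  shows "char_poly (four_block_mat A (const_mat n p (-1)) (const_mat p n (-1)) (q \<cdot>\<^sub>m 1\<^sub>m p))
           * ([:-q, 1:] * [:-s, 1:])
         = char_poly A * [:-q, 1:] ^ p * ([:-q, 1:] * [:-s, 1:] - of_nat (n * p))"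
    (is "char_poly ?M * (?\<alpha> * ?\<beta>) = _")
proof -
  let ?cA = "char_poly_matrix A" and ?J = "const_mat n n (of_nat p :: 'a poly)"
  let ?\<gamma> = "?\<alpha> * ?\<beta>"
  have cA: "?cA \<in> carrier_mat n n" using A by simp
  have J: "?J \<in> carrier_mat n n" by simp
  have entry: "?cA $$ (i, j) = (if i = j then [:0, 1:] else 0) - [:A $$ (i, j):]"
    if "i < n" "j < n" for i j
    using A that by (simp add: char_poly_matrix_def)
  have "char_poly_matrix ?M = four_block_mat ?cA (const_mat n p 1) (const_mat p n 1) (?\<alpha> \<cdot>\<^sub>m 1\<^sub>m p)"
    using A by (intro eq_matI) (auto simp: char_poly_matrix_def one_pCons)
  then have 1: "char_poly ?M * ?\<alpha> ^ n = det (?\<alpha> \<cdot>\<^sub>m ?cA - ?J) * ?\<alpha> ^ p"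
    using det_schur_complement_lower_right[OF cA, of "const_mat n p 1" p "const_mat p n 1" ?\<alpha>]
    by (simp add: char_poly_def const_mat_mult)
  have "?cA * ?J = ?\<beta> \<cdot>\<^sub>m ?J"
  proof (rule eq_matI)
    fix i j assume ij: "i < dim_row (?\<beta> \<cdot>\<^sub>m ?J)" "j < dim_col (?\<beta> \<cdot>\<^sub>m ?J)"
    then have "(?cA * ?J) $$ (i, j) = (\<Sum>k<n. ?cA $$ (i, k)) * of_nat p"
      using cA by (simp add: scalar_prod_def sum_distrib_right lessThan_atLeast0)
    also have "(\<Sum>k<n. ?cA $$ (i, k)) = [:0, 1:] - (\<Sum>k<n. [:A $$ (i, k):])"
      using ij by (simp add: entry sum_subtractf)
    also have "(\<Sum>k<n. [:A $$ (i, k):]) = [:s:]"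
      using row_sums[of i] ij by (simp add: poly_eq_iff coeff_sum coeff_pCons split: nat.splits)
    finally show "(?cA * ?J) $$ (i, j) = (?\<beta> \<cdot>\<^sub>m ?J) $$ (i, j)"
      using ij by simp
  qed (use cA in auto)
  then have "?cA * (?\<gamma> \<cdot>\<^sub>m 1\<^sub>m n - ?J) = ?\<gamma> \<cdot>\<^sub>m ?cA - ?\<beta> \<cdot>\<^sub>m ?J"
    using cA mult_scalar_mat(1)[OF cA, of ?\<gamma>]
    by (subst mult_minus_distrib_mat[OF cA, of _ n]) (auto simp del: mult_pCons_left)
  also have "\<dots> = ?\<beta> \<cdot>\<^sub>m (?\<alpha> \<cdot>\<^sub>m ?cA - ?J)"
    using cA by (intro eq_matI) (auto simp: algebra_simps simp del: mult_pCons_left mult_pCons_right)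
  finally have "det (?cA * (?\<gamma> \<cdot>\<^sub>m 1\<^sub>m n - ?J)) = ?\<beta> ^ n * det (?\<alpha> \<cdot>\<^sub>m ?cA - ?J)"
    using cA by simp
  then have 2: "char_poly A * det (?\<gamma> \<cdot>\<^sub>m 1\<^sub>m n - ?J) = ?\<beta> ^ n * det (?\<alpha> \<cdot>\<^sub>m ?cA - ?J)"
    using det_mult[OF cA minus_carrier_mat[OF J], of "?\<gamma> \<cdot>\<^sub>m 1\<^sub>m n"]
    by (simp only: char_poly_def)
  have 3: "det (?\<gamma> \<cdot>\<^sub>m 1\<^sub>m n - ?J) * ?\<gamma> = ?\<gamma> ^ n * (?\<gamma> - of_nat (n * p))"
    using det_scalar_minus_const_mat[of ?\<gamma> n "of_nat p"] by simp
  have "?\<gamma> ^ n * (char_poly ?M * ?\<gamma>) = (char_poly ?M * ?\<alpha> ^ n) * ?\<beta> ^ n * ?\<gamma>"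
    by (simp only: power_mult_distrib ac_simps)
  also have "\<dots> = ?\<alpha> ^ p * (?\<beta> ^ n * det (?\<alpha> \<cdot>\<^sub>m ?cA - ?J)) * ?\<gamma>"
    unfolding 1 by (simp only: ac_simps)
  also have "\<dots> = ?\<alpha> ^ p * char_poly A * (det (?\<gamma> \<cdot>\<^sub>m 1\<^sub>m n - ?J) * ?\<gamma>)"
    unfolding 2[symmetric] by (simp only: ac_simps)
  also have "\<dots> = ?\<gamma> ^ n * (char_poly A * ?\<alpha> ^ p * (?\<gamma> - of_nat (n * p)))"
    unfolding 3 by (simp only: ac_simps)
  \<comment> \<open>The common factor \<open>\<gamma>\<^sup>n\<close> can be cancelled because \<open>\<gamma>\<close> is monic.\<close>
  finally show ?thesis
    by (subst (asm) mult_left_cancel) auto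
qed

section \<open>Characteristic polynomials and their roots\<close>

text \<open>
  Two enumerations of the same index set give matrices that are conjugate by a permutation matrix.
\<close>

lemma char_poly_reindex:
  fixes f :: "'v \<Rightarrow> 'v \<Rightarrow> 'a :: comm_ring_1"
  assumes vs: "distinct vs" and ws: "distinct ws" and eq: "set vs = set ws"
  shows "char_poly (mat (length vs) (length vs) (\<lambda>(i, j). f (vs ! i) (vs ! j)))
       = char_poly (mat (length ws) (length ws) (\<lambda>(i, j). f (ws ! i) (ws ! j)))"
proof -
  define n where "n = length vs"
  have n: "length vs = n" "length ws = n"
    using vs ws eq by (auto simp: n_def dest!: distinct_card)
  define P where "P us us' = mat n n (\<lambda>(i, j). if us ! i = us' ! j then 1 else 0 :: 'a)" for us us' :: "'v list"
  have pick: "(\<Sum>k = 0..<n. (if x = us ! k then 1 else 0) * g (us ! k)) = g x"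
    if "distinct us" "length us = n" "x \<in> set us" for us x and g :: "'v \<Rightarrow> 'a"
  proof -
    have "(\<Sum>k = 0..<n. (if x = us ! k then 1 else 0) * g (us ! k))
        = (\<Sum>y\<in>set us. (if x = y then 1 else 0) * g y)"
      using that by (intro sum.reindex_bij_betw bij_betw_nth) (auto simp: lessThan_atLeast0)
    also have "\<dots> = (\<Sum>y\<in>set us. if x = y then g y else 0)" by (intro sum.cong) auto
    also have "\<dots> = g x" using that by simp
    finally show ?thesis .
  qed
  have in_set: "vs ! i \<in> set ws" "ws ! i \<in> set vs" "vs ! i \<in> set vs" "ws ! i \<in> set ws" if "i < n" for i
    using that n eq by (metis nth_mem)+
  define M where "M us = mat n n (\<lambda>(i, j). f (us ! i) (us ! j))" for us
  have inv: "P us us' * P us' us = 1\<^sub>m n"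
    if "distinct us" "distinct us'" "length us = n" "length us' = n" "set us = set us'" for us us'
  proof (rule eq_matI)
    fix i j assume ij: "i < dim_row (1\<^sub>m n :: 'a mat)" "j < dim_col (1\<^sub>m n :: 'a mat)"
    then have "(P us us' * P us' us) $$ (i, j) = (if us ! i = us ! j then 1 else 0)"
      using that pick[of us' "us ! i" "\<lambda>x. if x = us ! j then 1 else 0"] nth_mem[of i us]
      by (simp add: P_def scalar_prod_def cong: if_cong) 
    with ij that show "(P us us' * P us' us) $$ (i, j) = 1\<^sub>m n $$ (i, j)"
      by (simp add: nth_eq_iff_index_eq)
  qed (auto simp: P_def)
  have PM: "P vs ws * M ws = mat n n (\<lambda>(i, j). f (vs ! i) (ws ! j))"
    using pick[OF ws n(2) in_set(1)]
    by (intro eq_matI) (auto simp: P_def M_def scalar_prod_def)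
  have "P vs ws * M ws * P ws vs = M vs"
  proof (rule eq_matI)
    fix i j assume ij: "i < dim_row (M vs)" "j < dim_col (M vs)"
    have "(P vs ws * M ws * P ws vs) $$ (i, j)
        = (\<Sum>k = 0..<n. (if vs ! j = ws ! k then 1 else 0) * f (vs ! i) (ws ! k))"
      using ij unfolding PM by (auto simp: P_def M_def scalar_prod_def intro!: sum.cong)
    also have "\<dots> = f (vs ! i) (vs ! j)"
      using ij by (intro pick[OF ws n(2)] in_set) (auto simp: M_def)
    finally show "(P vs ws * M ws * P ws vs) $$ (i, j) = M vs $$ (i, j)"
      using ij by (simp add: M_def)
  qed (auto simp: P_def M_def)
  then have "similar_mat (M vs) (M ws)"
    using inv[of vs ws] inv[of ws vs] vs ws n eq
    by (intro similar_matI[of _ _ "P vs ws" "P ws vs" n]) (auto simp: M_def P_def)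
  then show ?thesis
    using char_poly_similar[of "M vs" "M ws"] by (simp add: M_def n)
qed

lemma trace_mult_commute:
  fixes A B :: "'a :: comm_semiring_0 mat"
  assumes "A \<in> carrier_mat n n" "B \<in> carrier_mat n n"
  shows "(\<Sum>i<n. (A * B) $$ (i, i)) = (\<Sum>i<n. (B * A) $$ (i, i))"
proof -
  have "(\<Sum>i<n. (A * B) $$ (i, i)) = (\<Sum>i<n. \<Sum>j<n. A $$ (i, j) * B $$ (j, i))"
    using assms by (simp add: scalar_prod_def lessThan_atLeast0)
  also have "\<dots> = (\<Sum>j<n. \<Sum>i<n. B $$ (j, i) * A $$ (i, j))"
    by (subst sum.swap) (simp add: mult.commute)
  also have "\<dots> = (\<Sum>i<n. (B * A) $$ (i, i))"
    using assms by (simp add: scalar_prod_def lessThan_atLeast0)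
  finally show ?thesis .
qed

lemma proots_linear_factors:
  fixes rs :: "'a :: idom list"
  shows "proots (\<Prod>r\<leftarrow>rs. [:- r, 1:]) = mset rs"
proof (induction rs)
  case (Cons r rs)
  have "(\<Prod>r\<leftarrow>rs. [:- r, 1:]) \<noteq> 0" by (auto simp: prod_list_zero_iff)
  with Cons show ?case by (simp add: proots_mult del: mult_pCons_left)
qed simp

text \<open>
  A matrix whose characteristic polynomial splits is similar to an upper triangular one, which has
  the roots on its diagonal; similar matrices have equal trace.
\<close>

lemma sum_roots_char_poly:
  fixes A :: "'a :: conjugatable_ordered_field mat"
  assumes A: "A \<in> carrier_mat n n" and roots: "char_poly A = (\<Prod>r\<leftarrow>rs. [:- r, 1:])"
  shows "sum_list rs = (\<Sum>i<n. A $$ (i, i))"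
proof -
  obtain B where B: "B \<in> carrier_mat n n" "upper_triangular B" "similar_mat A B"
    using schur_decomposition_exists[OF A roots] by blast
  then obtain P Q where wit: "similar_mat_wit A B P Q"
    unfolding similar_mat_def by blast
  note PQ = similar_mat_witD2[OF A wit]
  have "(\<Prod>r\<leftarrow>rs. [:- r, 1:]) = (\<Prod>r\<leftarrow>diag_mat B. [:- r, 1:])"
    using char_poly_similar[OF B(3)] char_poly_upper_triangular[OF B(1,2)] roots by simp
  then have "proots (\<Prod>r\<leftarrow>rs. [:- r, 1:]) = proots (\<Prod>r\<leftarrow>diag_mat B. [:- r, 1:])" by simp
  then have "mset rs = mset (diag_mat B)"
    by (simp only: proots_linear_factors)
  then have "sum_list rs = sum_list (diag_mat B)"
    by (metis sum_mset_sum_list)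
  also have "\<dots> = (\<Sum>i<n. B $$ (i, i))"
    using B(1) by (simp add: diag_mat_def sum_list_sum_nth lessThan_atLeast0)
  also have "\<dots> = (\<Sum>i<n. (Q * (P * B)) $$ (i, i))"
    using PQ(2,5) assoc_mult_mat[OF PQ(7) PQ(6) PQ(5)] by simp
  also have "\<dots> = (\<Sum>i<n. A $$ (i, i))"
    using PQ trace_mult_commute[of Q n "P * B"] by simp
  finally show ?thesis .
qed

text \<open>
  The characteristic polynomial splits over the complex numbers. If the complex eigenvalues are all
  real, its linear factors are real too, so that the real roots account for the full degree.
\<close>

lemma char_poly_linear_factors_of_real_eigenvalues:
  fixes A :: "real mat"
  assumes A: "A \<in> carrier_mat n n"
    and real: "\<And>z. eigenvalue (map_mat complex_of_real A) z \<Longrightarrow> z \<in> \<real> \<and> s \<le> Re z"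
  obtains rs where "char_poly A = (\<Prod>r\<leftarrow>rs. [:- r, 1:])" "length rs = n" "\<And>r. r \<in> set rs \<Longrightarrow> s \<le> r"
proof -
  let ?A = "map_mat complex_of_real A"
  interpret of_real: map_poly_comm_ring_hom complex_of_real ..
  have A': "?A \<in> carrier_mat n n" using A by simp
  obtain as where as: "char_poly ?A = (\<Prod>a\<leftarrow>as. [:- a, 1:])" "length as = n"
    using char_poly_factorized[OF A'] by blast
  have *: "complex_of_real (Re a) = a \<and> s \<le> Re a" if "a \<in> set as" for a
  proof -
    have "poly (char_poly ?A) a = 0"
      using that unfolding as(1) by (simp add: poly_prod_list prod_list_zero_iff image_iff o_def)
    then show ?thesis
      using real[of a] eigenvalue_root_char_poly[OF A', of a] by (simp add: complex_is_Real_iff complex_eq_iff)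
  qed
  have "map_poly complex_of_real (char_poly A) = (\<Prod>a\<leftarrow>as. [:- a, 1:])"
    unfolding as(1)[symmetric] by (rule of_real_hom.char_poly_hom[OF A, symmetric])
  also have "\<dots> = (\<Prod>a\<leftarrow>as. map_poly complex_of_real [:- Re a, 1:])"
    using * by (intro arg_cong[of _ _ prod_list] map_cong) auto
  also have "\<dots> = map_poly complex_of_real (\<Prod>r\<leftarrow>map Re as. [:- r, 1:])"
    by (simp add: of_real.hom_prod_list o_def)
  finally have "char_poly A = (\<Prod>r\<leftarrow>map Re as. [:- r, 1:])"
    by (simp add: poly_eq_iff coeff_map_poly)
  with that[of "map Re as"] as(2) * show thesis by auto
qed

text \<open>
  The matrix is \<open>s I\<close> plus the Laplacian of the weights \<open>W\<close>. For an eigenvector \<open>v\<close> one has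
  \<open>(z - s) \<Sum>\<^sub>i |v\<^sub>i|\<^sup>2 = (1/2) \<Sum>\<^sub>i\<^sub>j W\<^sub>i\<^sub>j |v\<^sub>i - v\<^sub>j|\<^sup>2\<close>. The complex \<open>v\<close> makes this one identity yield both
  that \<open>z\<close> is real and that it is at least \<open>s\<close>.
\<close>

lemma eigenvalue_shifted_weighted_laplacian:
  fixes W :: "nat \<Rightarrow> nat \<Rightarrow> real" and s :: real
  assumes sym: "\<And>i j. i < n \<Longrightarrow> j < n \<Longrightarrow> W i j = W j i"
    and nonneg: "\<And>i j. i < n \<Longrightarrow> j < n \<Longrightarrow> W i j \<ge> 0"
  defines "A \<equiv> mat n n (\<lambda>(i, j). (if i = j then s + (\<Sum>k<n. W i k) else 0) - W i j)"
  assumes ev: "eigenvalue (map_mat complex_of_real A) z"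
  shows "z \<in> \<real> \<and> s \<le> Re z"
proof -
  obtain v where v: "v \<in> carrier_vec n" "v \<noteq> 0\<^sub>v n" "map_mat complex_of_real A *\<^sub>v v = z \<cdot>\<^sub>v v"
    using ev unfolding eigenvalue_def eigenvector_def A_def by auto
  have row: "s * v $ i + (\<Sum>j<n. W i j * (v $ i - v $ j)) = z * v $ i" if i: "i < n" for i
  proof -
    have "z * v $ i = (\<Sum>j<n. complex_of_real (A $$ (i, j)) * v $ j)"
      using arg_cong[OF v(3), of "\<lambda>u. u $ i"] v(1) i
      by (simp add: scalar_prod_def lessThan_atLeast0 A_def)
    also have "\<dots> = (\<Sum>j<n. (if i = j then of_real (s + (\<Sum>k<n. W i k)) * v $ j else 0) - W i j * v $ j)"
      using i by (intro sum.cong) (auto simp: A_def algebra_simps)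
    also have "\<dots> = of_real (s + (\<Sum>k<n. W i k)) * v $ i - (\<Sum>j<n. W i j * v $ j)"
      using i by (simp add: sum_subtractf)
    also have "\<dots> = s * v $ i + (\<Sum>j<n. W i j * (v $ i - v $ j))"
      by (simp add: algebra_simps sum_subtractf sum_distrib_left)
    finally show ?thesis ..
  qed
  define q where "q = (\<Sum>i<n. (cmod (v $ i))\<^sup>2)"
  define e where "e = (\<Sum>i<n. \<Sum>j<n. W i j * (cmod (v $ i - v $ j))\<^sup>2)"
  define d where "d = (\<Sum>i<n. \<Sum>j<n. cnj (v $ i) * (W i j * (v $ i - v $ j)))"
  have "(z - s) * q = (\<Sum>i<n. cnj (v $ i) * (z * v $ i - s * v $ i))"
    by (simp add: q_def sum_distrib_left complex_norm_square algebra_simps del: of_real_power)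
  also have "\<dots> = d"
    unfolding d_def
  proof (rule sum.cong[OF refl])
    fix i assume "i \<in> {..<n}"
    then have "z * v $ i - s * v $ i = (\<Sum>j<n. W i j * (v $ i - v $ j))"
      by (subst row[symmetric]) auto
    then show "cnj (v $ i) * (z * v $ i - s * v $ i) = (\<Sum>j<n. cnj (v $ i) * (W i j * (v $ i - v $ j)))"
      by (simp add: sum_distrib_left)
  qed
  finally have zd: "(z - s) * q = d" .
  \<comment> \<open>Exchanging the two ends of each edge and adding symmetrises \<open>d\<close>.\<close>
  have "d = (\<Sum>i<n. \<Sum>j<n. cnj (v $ j) * (W i j * (v $ j - v $ i)))"
    unfolding d_def by (subst sum.swap) (simp add: sym)
  then have "d + d = (\<Sum>i<n. \<Sum>j<n. cnj (v $ i) * (W i j * (v $ i - v $ j)) + cnj (v $ j) * (W i j * (v $ j - v $ i)))"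
    unfolding sum.distrib d_def by simp
  also have "\<dots> = e"
    by (simp add: e_def complex_norm_square algebra_simps del: of_real_power)
  finally have "2 * d = e" by simp
  with zd have 2: "2 * ((z - s) * q) = e" by simp
  have "e \<ge> 0" unfolding e_def using nonneg by (intro sum_nonneg mult_nonneg_nonneg) auto
  obtain i where "i < n" "v $ i \<noteq> 0"
    using v(1,2) by (metis carrier_vecD eq_vecI index_zero_vec)
  then have "q > 0"
    unfolding q_def by (intro sum_pos2[of _ i]) auto
  then have "z = of_real (s + e / (2 * q))"
    using 2 by (auto simp: field_simps)
  with \<open>q > 0\<close> \<open>e \<ge> 0\<close> show ?thesis by simp
qed

section \<open>Counting vertices and edges\<close>

lemma pair_graphD:
  assumes "pair_graph G"
  shows "finite (pverts G)" "parcs G \<subseteq> pverts G \<times> pverts G" "sym (parcs G)" "irrefl (parcs G)"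
    "finite (parcs G)"
  using assms finite_subset[of "parcs G" "pverts G \<times> pverts G"] unfolding pair_graph_iff by auto

lemma out_degree_eq_card_neighbours:
  "out_degree (with_proj G) v = card {w. (v, w) \<in> parcs G}"
proof -
  have "out_arcs (with_proj G) v = Pair v ` {w. (v, w) \<in> parcs G}"
    by (auto simp: out_arcs_def)
  then show ?thesis
    unfolding out_degree_def by (simp add: card_image inj_on_def)
qed

lemma sum_out_degree:
  assumes "pair_graph G"
  shows "(\<Sum>v\<in>pverts G. out_degree (with_proj G) v) = card (parcs G)"
proof -
  note G = pair_graphD[OF assms]
  have "parcs G = Sigma (pverts G) (\<lambda>v. {w. (v, w) \<in> parcs G})"
    using G(2) by auto
  moreover have "finite {w. (v, w) \<in> parcs G}" for v
    using G(1,2) by (auto intro: finite_subset)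
  ultimately show ?thesis
    using card_SigmaI[OF G(1), of "\<lambda>v. {w. (v, w) \<in> parcs G}"]
    by (simp add: out_degree_eq_card_neighbours)
qed

text \<open>
  Every edge comes from exactly two arcs, by symmetry and absence of loops.
\<close>

lemma card_parcs_eq_twice_num_edges:
  assumes "pair_graph G"
  shows "card (parcs G) = 2 * num_edges G"
proof -
  note G = pair_graphD[OF assms]
  let ?E = "{{u, v} |u v. (u, v) \<in> parcs G}"
  have E: "?E = (\<lambda>(u, v). {u, v}) ` parcs G" by auto
  have fin: "finite ?E" unfolding E using G(5) by blast
  have "card (parcs G) = (\<Sum>e\<in>?E. card {a \<in> parcs G. (case a of (u, v) \<Rightarrow> {u, v}) = e})"
    unfolding E card_eq_sum[of "parcs G"]
    by (subst sum.image_gen[OF G(5), of _ "\<lambda>(u, v). {u, v}"]) simp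
  also have "\<dots> = (\<Sum>e\<in>?E. 2)"
  proof (rule sum.cong[OF refl])
    fix e assume "e \<in> ?E"
    then obtain u v where uv: "e = {u, v}" "(u, v) \<in> parcs G" by auto
    with G(3,4) have "(v, u) \<in> parcs G" "u \<noteq> v"
      by (auto dest: symD simp: irrefl_def)
    with uv have "{a \<in> parcs G. (case a of (u, v) \<Rightarrow> {u, v}) = e} = {(u, v), (v, u)}"
      by (auto simp: doubleton_eq_iff)
    with \<open>u \<noteq> v\<close> show "card {a \<in> parcs G. (case a of (u, v) \<Rightarrow> {u, v}) = e} = 2" by simp
  qed
  also have "\<dots> = 2 * num_edges G" by (simp add: num_edges_def)
  finally show ?thesis .
qed

lemma average_degree_eq:
  assumes "pair_graph G"
  shows "average_degree G = 2 * real (num_edges G) / real (num_verts G)"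
  unfolding average_degree_def
  using sum_out_degree[OF assms] card_parcs_eq_twice_num_edges[OF assms]
  by (simp flip: of_nat_sum)

lemma num_verts_graph_join:
  assumes "finite (pverts G)" "finite (pverts H)"
  shows "num_verts (graph_join G H) = num_verts G + num_verts H"
  using assms by (simp add: num_verts_def graph_join_def card_Plus)

lemma out_degree_graph_join:
  assumes G: "pair_graph G" and H: "pair_graph H"
  shows "u \<in> pverts G \<Longrightarrow> out_degree (with_proj (graph_join G H)) (Inl u)
           = out_degree (with_proj G) u + num_verts H"
    and "w \<in> pverts H \<Longrightarrow> out_degree (with_proj (graph_join G H)) (Inr w)
           = out_degree (with_proj H) w + num_verts G"
proof -
  note G = pair_graphD[OF G] and H = pair_graphD[OF H]
  have fin: "finite {w. (v, w) \<in> parcs G}" "finite {w. (v', w) \<in> parcs H}" for v v'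
    using G(1,2) H(1,2) by (auto intro: finite_subset)
  {
    assume "u \<in> pverts G"
    then have "{w. (Inl u, w) \<in> parcs (graph_join G H)} = {w. (u, w) \<in> parcs G} <+> pverts H"
      by (force simp: graph_join_def)
    with fin H(1) show "out_degree (with_proj (graph_join G H)) (Inl u)
           = out_degree (with_proj G) u + num_verts H"
      by (simp add: out_degree_eq_card_neighbours card_Plus num_verts_def)
  next
    assume "w \<in> pverts H"
    then have "{v. (Inr w, v) \<in> parcs (graph_join G H)} = pverts G <+> {v. (w, v) \<in> parcs H}"
      by (force simp: graph_join_def)
    with fin G(1) show "out_degree (with_proj (graph_join G H)) (Inr w)
           = out_degree (with_proj H) w + num_verts G"
      by (simp add: out_degree_eq_card_neighbours card_Plus num_verts_def)
  }
qed

lemma num_edges_graph_join: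
  assumes G: "pair_graph G" and H: "pair_graph H"
  shows "num_edges (graph_join G H) = num_edges G + num_edges H + num_verts G * num_verts H"
proof -
  note fin = pair_graphD(1)[OF G] pair_graphD(1)[OF H]
  let ?d = "\<lambda>K v. out_degree (with_proj K) v"
  have "2 * num_edges (graph_join G H) = (\<Sum>v\<in>pverts (graph_join G H). ?d (graph_join G H) v)"
    using pair_graph_graph_join[OF G H] sum_out_degree card_parcs_eq_twice_num_edges by metis
  also have "\<dots> = (\<Sum>v\<in>pverts G. ?d (graph_join G H) (Inl v)) + (\<Sum>v\<in>pverts H. ?d (graph_join G H) (Inr v))"
    using fin by (simp add: graph_join_def sum.Plus)
  also have "\<dots> = (\<Sum>v\<in>pverts G. ?d G v) + (\<Sum>v\<in>pverts H. ?d H v) + 2 * (num_verts G * num_verts H)"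
    by (simp add: out_degree_graph_join[OF G H] sum.distrib num_verts_def)
  also have "\<dots> = 2 * (num_edges G + num_edges H + num_verts G * num_verts H)"
    by (simp add: sum_out_degree G H card_parcs_eq_twice_num_edges)
  finally show ?thesis by simp
qed

lemma edgeless_graph_counts [simp]:
  "num_verts (edgeless_graph p) = p" "num_edges (edgeless_graph p) = 0"
  "out_degree (with_proj (edgeless_graph p)) v = 0"
  by (auto simp: num_verts_def num_edges_def edgeless_graph_def out_degree_eq_card_neighbours)

lemma embed_graph_counts:
  "num_verts (embed_graph G) = num_verts G" "card (parcs (embed_graph G)) = card (parcs G)"
  by (auto simp: embed_graph_def num_verts_def intro!: card_image simp: inj_on_def)

text \<open>
  The arcs from the \<open>X\<close> side to the \<open>Y\<close> side are a copy of the old arcs together with one loop at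
  each vertex; the arcs back are their converses.
\<close>

lemma extended_double_cover_counts:
  assumes "pair_graph G"
  shows "num_verts (extended_double_cover G) = 2 * num_verts G"
    and "card (parcs (extended_double_cover G)) = 2 * (card (parcs G) + num_verts G)"
proof -
  note G = pair_graphD[OF assms]
  show "num_verts (extended_double_cover G) = 2 * num_verts G"
    using G(1) unfolding num_verts_def extended_double_cover_def Let_def
    by (simp, subst card_Un_disjoint) (auto simp: card_image inj_on_def)
  let ?E = "{(X u, Y v) | u v. u \<in> pverts G \<and> v \<in> pverts G \<and> (u = v \<or> (u, v) \<in> parcs G)}"
  have "?E = map_prod X Y ` (parcs G \<union> Id_on (pverts G))"
    using G(2) by (auto simp: image_iff)
  moreover have "inj_on (map_prod X Y) (parcs G \<union> Id_on (pverts G))"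
    by (auto simp: inj_on_def)
  ultimately have "card ?E = card (parcs G \<union> Id_on (pverts G))"
    by (simp add: card_image)
  also have "\<dots> = card (parcs G) + card (Id_on (pverts G))"
    using G(1,4,5) by (intro card_Un_disjoint) (auto simp: irrefl_def Id_on_def)
  also have "Id_on (pverts G) = (\<lambda>v. (v, v)) ` pverts G" by auto
  also have "card \<dots> = num_verts G" by (simp add: card_image inj_on_def num_verts_def)
  finally have card: "card ?E = card (parcs G) + num_verts G" .
  have fin: "finite ?E"
    unfolding \<open>?E = _\<close> using G(1,5) by (simp add: Id_on_def)
  have "card (?E \<union> ?E\<inverse>) = card ?E + card (?E\<inverse>)"
    using fin by (intro card_Un_disjoint) auto
  with card show "card (parcs (extended_double_cover G)) = 2 * (card (parcs G) + num_verts G)"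
    by (simp add: extended_double_cover_def Let_def card_inverse)
qed

lemma iterated_double_cover_counts:
  assumes "pair_graph G"
  shows "num_verts (iterated_double_cover t G) = 2 ^ t * num_verts G"
    and "card (parcs (iterated_double_cover t G)) = 2 ^ t * (card (parcs G) + t * num_verts G)"
proof (induction t)
  case 0
  case 1 show ?case by (simp add: iterated_double_cover_def embed_graph_counts)
  case 2 show ?case by (simp add: iterated_double_cover_def embed_graph_counts)
next
  case (Suc t)
  have step: "iterated_double_cover (Suc t) G = extended_double_cover (iterated_double_cover t G)"
    by (simp add: iterated_double_cover_def)
  note counts = extended_double_cover_counts[OF pair_graph_iterated_double_cover[OF assms, of t]]
  case 1 show ?case by (simp add: step counts Suc)
  case 2 show ?case by (simp add: step counts Suc algebra_simps)
qed

section \<open>The Laplacian of a join with an edgeless graph\<close>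

lemma vertex_list_enumerates:
  assumes "finite (pverts G)"
  shows "distinct (vertex_list G)" "set (vertex_list G) = pverts G"
  using someI_ex[of "\<lambda>vs. distinct vs \<and> set vs = pverts G"] finite_distinct_list[OF assms]
  unfolding vertex_list_def by blast+

lemma length_vertex_list: "finite (pverts G) \<Longrightarrow> length (vertex_list G) = num_verts G"
  using vertex_list_enumerates[of G] distinct_card[of "vertex_list G"] by (simp add: num_verts_def)

lemma laplacian_mat_carrier: "laplacian_mat vs G \<in> carrier_mat (length vs) (length vs)"
  unfolding laplacian_mat_def adjacency_mat_def by (intro minus_carrier_mat) auto

lemma char_poly_laplacian_mat_eq:
  assumes "distinct vs" "distinct ws" "set vs = set ws"
  shows "char_poly (laplacian_mat vs G) = char_poly (laplacian_mat ws G)"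
proof -
  define f where "f u v = (if u = v then real (out_degree (with_proj G) u) else 0)
    - of_bool ((u, v) \<in> parcs G)" for u v
  have "laplacian_mat us G = mat (length us) (length us) (\<lambda>(i, j). f (us ! i) (us ! j))"
    if "distinct us" for us
    using that
    by (intro eq_matI)
      (auto simp: laplacian_mat_def degree_mat_def adjacency_mat_def f_def nth_eq_iff_index_eq)
  with char_poly_reindex[OF assms, of f] assms show ?thesis by simp
qed

lemma real_out_degree_eq_sum:
  assumes G: "pair_graph G" and vs: "distinct vs" "set vs = pverts G"
  shows "real (out_degree (with_proj G) v) = (\<Sum>k<length vs. of_bool ((v, vs ! k) \<in> parcs G))"
proof -
  note G = pair_graphD[OF G]
  have "{w. (v, w) \<in> parcs G} = {w \<in> set vs. (v, w) \<in> parcs G}"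
    using G(2) vs by auto
  then have "real (out_degree (with_proj G) v) = (\<Sum>w\<in>set vs. of_bool ((v, w) \<in> parcs G))"
    by (simp add: out_degree_eq_card_neighbours Int_def flip: sum.inter_filter)
  also have "\<dots> = (\<Sum>k<length vs. of_bool ((v, vs ! k) \<in> parcs G))"
    using vs(1) by (intro sum.reindex_bij_betw[symmetric] bij_betw_nth) auto
  finally show ?thesis .
qed

text \<open>
  Listing the isolated vertices last puts the Laplacian into the block form of
  \<open>char_poly_join_block\<close>. The upper left block is \<open>p I\<close> plus the Laplacian of \<open>G\<close>, since the join raises
  each degree in \<open>G\<close> by \<open>p\<close>.
\<close>

lemma laplacian_mat_join_edgeless:
  assumes G: "pair_graph G" and vs: "distinct vs" "set vs = pverts G"
  defines "n \<equiv> num_verts G"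
  shows "laplacian_mat (map Inl vs @ map Inr [0..<p]) (graph_join G (edgeless_graph p))
       = four_block_mat
           (mat n n (\<lambda>(i, j). (if i = j then real p + (\<Sum>k<n. of_bool ((vs ! i, vs ! k) \<in> parcs G)) else 0)
              - of_bool ((vs ! i, vs ! j) \<in> parcs G)))
           (const_mat n p (- 1)) (const_mat p n (- 1)) (real n \<cdot>\<^sub>m 1\<^sub>m p)"
    (is "laplacian_mat ?us ?H = ?B")
proof -
  have len: "length vs = n"
    using vs distinct_card[of vs] by (simp add: n_def num_verts_def)
  have nth: "?us ! i = (if i < n then Inl (vs ! i) else Inr (i - n))" if "i < n + p" for i
    using that len by (auto simp: nth_append)
  have mem: "vs ! i \<in> pverts G" if "i < n" for i using that len vs by auto
  have deg: "out_degree (with_proj ?H) (Inl (vs ! i)) = out_degree (with_proj G) (vs ! i) + p"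
    if "i < n" for i
    using out_degree_graph_join(1)[OF G pair_graph_edgeless_graph mem[OF that]] by simp
  have deg': "out_degree (with_proj ?H) (Inr i) = n" if "i < p" for i
  proof -
    have "i \<in> pverts (edgeless_graph p)" using that by (simp add: edgeless_graph_def)
    then show ?thesis
      using out_degree_graph_join(2)[OF G pair_graph_edgeless_graph] by (simp add: n_def)
  qed
  have arcs: "(Inl u, Inl v) \<in> parcs ?H \<longleftrightarrow> (u, v) \<in> parcs G"
    "(Inr i, Inr j) \<notin> parcs ?H"
    "(Inl u, Inr j) \<in> parcs ?H \<longleftrightarrow> u \<in> pverts G \<and> j < p"
    "(Inr j, Inl u) \<in> parcs ?H \<longleftrightarrow> u \<in> pverts G \<and> j < p" for u v i j
    by (auto simp: graph_join_def edgeless_graph_def intro: rev_image_eqI)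
  show ?thesis
  proof (rule eq_matI)
    fix i j assume "i < dim_row ?B" "j < dim_col ?B"
    then have ij: "i < n + p" "j < n + p" by auto
    then have "laplacian_mat ?us ?H $$ (i, j)
        = (if i = j then real (out_degree (with_proj ?H) (?us ! i)) else 0)
          - of_bool ((?us ! i, ?us ! j) \<in> parcs ?H)"
      by (simp add: laplacian_mat_def degree_mat_def adjacency_mat_def len)
    also have "\<dots> = ?B $$ (i, j)"
      using ij by (auto simp: nth arcs mem deg deg' real_out_degree_eq_sum[OF G vs] len)
    finally show "laplacian_mat ?us ?H $$ (i, j) = ?B $$ (i, j)" .
  qed (auto simp: laplacian_mat_def adjacency_mat_def len)
qed

section \<open>Spectrum and energy of the join\<close>

text \<open>
  Here \<open>R\<close> is the spectrum of \<open>p I + L(G)\<close>. All its rows sum to \<open>p\<close>, so the correction factor of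
  \<open>char_poly_join_block\<close> is \<open>(x - n) (x - p) - n p = x (x - (n + p))\<close>. The two eigenvalues added on the left
  express, without subtraction of multisets, that one \<open>p\<close> drops out of \<open>R\<close> (the shift of the
  Laplacian eigenvalue \<open>0\<close> of \<open>G\<close>) and one \<open>n\<close> out of the \<open>p\<close> copies of \<open>n\<close>. If
  \<open>n = 0\<close>, it is instead \<open>n + p\<close> that cancels the added \<open>p\<close>; if \<open>p = 0\<close>, it cancels the added \<open>n\<close>.
\<close>

lemma laplacian_eigenvalues_join_edgeless:
  assumes G: "pair_graph G"
  defines "n \<equiv> num_verts G"
  obtains R where "size R = n" "\<And>r. r \<in># R \<Longrightarrow> real p \<le> r"
    "\<Sum>\<^sub># R = real (n * p + 2 * num_edges G)"
    "laplacian_eigenvalues (graph_join G (edgeless_graph p)) + {#real n, real p#}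
       = R + replicate_mset p (real n) + {#0, real (n + p)#}"
proof -
  let ?H = "graph_join G (edgeless_graph p)"
  define vs where "vs = vertex_list G"
  note G' = pair_graphD[OF G]
  have vs: "distinct vs" "set vs = pverts G" "length vs = n"
    using vertex_list_enumerates length_vertex_list G' by (auto simp: vs_def n_def)
  define W where "W i j = (of_bool ((vs ! i, vs ! j) \<in> parcs G) :: real)" for i j
  define A where "A = mat n n (\<lambda>(i, j). (if i = j then real p + (\<Sum>k<n. W i k) else 0) - W i j)"
  have A: "A \<in> carrier_mat n n" by (simp add: A_def)
  let ?M = "four_block_mat A (const_mat n p (- 1)) (const_mat p n (- 1)) (real n \<cdot>\<^sub>m 1\<^sub>m p)"
  have row_sums: "(\<Sum>j<n. A $$ (i, j)) = real p" if "i < n" for i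
    using that by (simp add: A_def sum_subtractf)
  have W: "W i j = W j i" "0 \<le> W i j" for i j
    using G'(3) by (auto simp: W_def sym_def)
  have "z \<in> \<real> \<and> real p \<le> Re z" if "eigenvalue (map_mat complex_of_real A) z" for z
    using eigenvalue_shifted_weighted_laplacian[of n W "real p" z] W that unfolding A_def by blast
  then obtain rs where rs: "char_poly A = (\<Prod>r\<leftarrow>rs. [:- r, 1:])" "length rs = n"
    "\<And>r. r \<in> set rs \<Longrightarrow> real p \<le> r"
    using char_poly_linear_factors_of_real_eigenvalues[OF A] by blast
  have diag: "A $$ (i, i) = real p + real (out_degree (with_proj G) (vs ! i))" if "i < n" for i
    using that G'(4) vs
    by (simp add: A_def W_def real_out_degree_eq_sum[OF G vs(1,2)] irrefl_def)
  have "sum_list rs = n * real p + (\<Sum>i<n. real (out_degree (with_proj G) (vs ! i)))"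
    unfolding sum_roots_char_poly[OF A rs(1)] by (simp add: diag sum.distrib)
  also have "(\<Sum>i<n. real (out_degree (with_proj G) (vs ! i)))
      = (\<Sum>v\<in>pverts G. real (out_degree (with_proj G) v))"
    using vs by (intro sum.reindex_bij_betw bij_betw_nth) auto
  also have "\<dots> = real (2 * num_edges G)"
    using sum_out_degree[OF G] card_parcs_eq_twice_num_edges[OF G] by (simp flip: of_nat_sum)
  finally have sum: "sum_list rs = real (n * p + 2 * num_edges G)" by simp
  have fin: "finite (pverts ?H)"
    using pair_graphD(1)[OF pair_graph_graph_join[OF G pair_graph_edgeless_graph]] .
  have "set (vertex_list ?H) = set (map Inl vs @ map Inr [0..<p])"
    unfolding vertex_list_enumerates(2)[OF fin] using vs by (auto simp: graph_join_def edgeless_graph_def)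
  moreover have "distinct (map Inl vs @ map Inr [0..<p])"
    using vs by (auto simp: distinct_map)
  ultimately have "char_poly (laplacian_mat (vertex_list ?H) ?H)
      = char_poly (laplacian_mat (map Inl vs @ map Inr [0..<p]) ?H)"
    using vertex_list_enumerates(1)[OF fin] by (intro char_poly_laplacian_mat_eq)
  also have "\<dots> = char_poly ?M"
    unfolding laplacian_mat_join_edgeless[OF G vs(1,2)] A_def W_def n_def ..
  finally have "char_poly (laplacian_mat (vertex_list ?H) ?H) = char_poly ?M" .
  moreover have "[:- real n, 1:] * [:- real p, 1:] - of_nat (n * p) = [:0, 1:] * [:- real (n + p), 1:]"
    by (simp add: of_nat_poly)
  ultimately have "char_poly (laplacian_mat (vertex_list ?H) ?H) * ([:- real n, 1:] * [:- real p, 1:])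
      = (\<Prod>r\<leftarrow>rs. [:- r, 1:]) * [:- real n, 1:] ^ p * ([:- 0, 1:] * [:- real (n + p), 1:])"
    using char_poly_join_block[OF A row_sums, of p "real n"] rs(1) by simp
  then have "proots (char_poly (laplacian_mat (vertex_list ?H) ?H) * ([:- real n, 1:] * [:- real p, 1:]))
      = proots ((\<Prod>r\<leftarrow>rs. [:- r, 1:]) * [:- real n, 1:] ^ p * ([:- 0, 1:] * [:- real (n + p), 1:]))"
    by (rule arg_cong)
  moreover have "char_poly (laplacian_mat (vertex_list ?H) ?H) \<noteq> 0"
    using degree_monic_char_poly[of "laplacian_mat (vertex_list ?H) ?H" "length (vertex_list ?H)"]
      laplacian_mat_carrier[of "vertex_list ?H" ?H] by auto
  moreover have "(\<Prod>r\<leftarrow>rs. [:- r, 1:]) \<noteq> 0" by (auto simp: prod_list_zero_iff)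
  ultimately have "laplacian_eigenvalues ?H + {#real n, real p#}
      = mset rs + replicate_mset p (real n) + {#0, real (n + p)#}"
    unfolding laplacian_eigenvalues_def
    by (simp add: proots_mult proots_power proots_linear_factors add_mset_commute add.commute
        del: mult_pCons_left mult_pCons_right)
  with that[of "mset rs"] rs sum show thesis by (simp add: sum_mset_sum_list)
qed

text \<open>
  The bound on \<open>S\<close> is equivalent to \<open>a \<le> p\<close>, and together with \<open>n \<le> a\<close> it fixes the sign of every
  \<open>\<nu> - a\<close>. Hence the spectrum of \<open>p I + L(G)\<close> enters only by its size and its sum.
\<close>

lemma laplacian_energy_join_edgeless:
  fixes G :: "'a pair_pre_digraph" and p :: nat and n S a :: real
  defines "H \<equiv> graph_join G (edgeless_graph p)"
  defines "n \<equiv> real (num_verts G)" and "S \<equiv> 2 * real (num_edges G)"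
    and "a \<equiv> 2 * real (num_edges H) / real (num_verts H)"
  assumes G: "pair_graph G" and p: "p > 0" "n \<le> p" and S: "S \<le> p * (p - n)"
  shows "a = (S + 2 * p * n) / (p + n)"
    and "laplacian_energy H = (p - n) * a + 2 * n + S"
proof -
  have fin: "finite (pverts G)" using pair_graphD[OF G] by simp
  show a: "a = (S + 2 * p * n) / (p + n)"
    using num_verts_graph_join[OF fin, of "edgeless_graph p"]
      num_edges_graph_join[OF G pair_graph_edgeless_graph, of p]
      pair_graphD(1)[OF pair_graph_edgeless_graph, of p]
    by (simp add: a_def H_def n_def S_def algebra_simps)
  have "0 \<le> n" "0 \<le> S" by (simp_all add: n_def S_def)
  with p have pn: "0 < p + n" by linarith
  have "n * n \<le> p * n" using p(2) \<open>0 \<le> n\<close> by (rule mult_right_mono)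
  with \<open>0 \<le> S\<close> pn have "n \<le> a" by (simp add: a field_simps)
  have "a \<le> p" using S pn by (simp add: a field_simps)
  obtain R where R: "size R = num_verts G" "\<And>r. r \<in># R \<Longrightarrow> real p \<le> r" "\<Sum>\<^sub># R = n * p + S"
    "laplacian_eigenvalues H + {#n, real p#} = R + replicate_mset p n + {#0, n + p#}"
    using laplacian_eigenvalues_join_edgeless[OF G, of p] unfolding n_def S_def H_def by auto
  have "(\<Sum>r\<in>#R. \<bar>r - a\<bar>) = (\<Sum>r\<in>#R. r - a)"
    using R(2) \<open>a \<le> p\<close> by (intro arg_cong[of _ _ sum_mset] image_mset_cong) fastforce
  also have "\<dots> = n * p + S - n * a"
  proof -
    have "(\<Sum>r\<in>#R. r - a) = \<Sum>\<^sub># R - real (size R) * a"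
      by (induction R) (auto simp: algebra_simps)
    then show ?thesis using R(1,3) by (simp add: n_def)
  qed
  finally have sumR: "(\<Sum>r\<in>#R. \<bar>r - a\<bar>) = n * p + S - n * a" .
  have "laplacian_energy H + \<bar>n - a\<bar> + \<bar>p - a\<bar>
      = (\<Sum>r\<in>#R. \<bar>r - a\<bar>) + p * \<bar>n - a\<bar> + \<bar>0 - a\<bar> + \<bar>n + p - a\<bar>"
    using arg_cong[OF R(4), of "\<lambda>M. \<Sum>\<nu>\<in>#M. \<bar>\<nu> - a\<bar>"]
    by (simp add: laplacian_energy_def a_def)
  then show "laplacian_energy H = (p - n) * a + 2 * n + S"
    using \<open>n \<le> a\<close> \<open>a \<le> p\<close> \<open>0 \<le> n\<close> unfolding sumR by (simp add: algebra_simps)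
qed

theorem theorem4p4:
  fixes G :: "'a pair_pre_digraph"
    and H :: "('a cover_vertex + nat) pair_pre_digraph"
    and n m n' m' p k t :: nat
  assumes "pair_graph G"
    and "n = num_verts G"
    and "m = num_edges G"
    and "t \<ge> 1"
    and "k \<ge> t + 2"
    and "p \<ge> 2 ^ t * n + k"
    and "real m \<le> (real k - real t) * real n / 2 + (real k)\<^sup>2 / 2 ^ (t + 1)"
    and "H = graph_join (iterated_double_cover t G) (edgeless_graph p)"
    and "n' = num_verts H"
    and "m' = num_edges H"
  shows "laplacian_energy H =
           2 ^ t * real n * (real t + 2)
           + (real p - 2 ^ t * real n) * (2 * real m' / real n')
           + 2 ^ t * (2 * real m)
         \<and> 2 * real m' / real n' =
           (2 ^ (t + 1) * real m + 2 ^ t * real t * real n + 2 ^ (t + 1) * real p * real n)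
             / (real p + 2 ^ t * real n)
         \<and> average_degree H = 2 * real m' / real n'"
proof -
  let ?K = "iterated_double_cover t G"
  note G = assms(1)
  have K: "pair_graph ?K" by (rule pair_graph_iterated_double_cover[OF G])
  define N where "N = 2 ^ t * real n"
  define S where "S = 2 ^ t * (2 * real m + t * n)"
  have N: "real (num_verts ?K) = N"
    using iterated_double_cover_counts(1)[OF G] assms(2) by (simp add: N_def)
  have S: "2 * real (num_edges ?K) = S"
    using arg_cong[OF card_parcs_eq_twice_num_edges[OF K], of real]
      iterated_double_cover_counts(2)[OF G] card_parcs_eq_twice_num_edges[OF G] assms(2,3)
    by (simp add: S_def)
  have "real (2 ^ t * n + k) \<le> real p" using assms(6) by (rule of_nat_mono)
  then have p: "N + k \<le> p" by (simp add: N_def)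
  have "N \<ge> 0" by (simp add: N_def)
  have "2 ^ (t + 1) * real m \<le> 2 ^ (t + 1) * ((real k - real t) * real n / 2 + (real k)\<^sup>2 / 2 ^ (t + 1))"
    using assms(7) by (rule mult_left_mono) simp
  also have "\<dots> = (real k - real t) * N + (real k)\<^sup>2"
    by (simp add: N_def field_simps)
  finally have "S \<le> (N + k) * k"
    by (simp add: S_def N_def algebra_simps power2_eq_square)
  also have "\<dots> \<le> p * (p - N)"
    using p \<open>N \<ge> 0\<close> by (intro mult_mono) auto
  finally have "S \<le> p * (p - N)" .
  moreover have "p > 0" "N \<le> p" using assms(5,6) p by auto
  ultimately have *: "2 * real m' / real n' = (S + 2 * p * N) / (p + N)"
    "laplacian_energy H = (p - N) * (2 * real m' / real n') + 2 * N + S"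
    using laplacian_energy_join_edgeless[OF K, of p] unfolding N S assms(8-10) by auto
  have "average_degree H = 2 * real m' / real n'"
    using average_degree_eq[OF pair_graph_graph_join[OF K pair_graph_edgeless_graph]] assms(8-10)
    by simp
  with * show ?thesis
    by (simp add: N_def S_def algebra_simps)
qed

end
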